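(* Let $(X,d)$ be a finite ultrametric space with $|X|\ge2$ and let $n=|X|-1$. Then $(X,d)\in\mathfrak{R}$ if and only if for every positive $r\in\operatorname{Sp}(X)$ and every node of the representing tree $T_X$ labeled by $r$, the graph $G'_{r,X}$ is isomorphic to the star $K_{1,n-p}$, where $p$ is the level of that node.
   Context: An ultrametric space is a metric space with $d(x,y)\le\max\{d(x,z),d(z,y)\}$ for all $x,y,z$. $\operatorname{Iso}(X)$ is the group of isometries of $(X,d)$ (bijective distance-preserving maps $X\to X$), and $\operatorname{Fix}(g)=\{x\in X: g(x)=x\}$. $\mathfrak{R}$ denotes the class of all finite ultrametric spaces $(X,d)$ with $\min_{g\in \operatorname{Iso}(X)}|\operatorname{Fix}(g)|=|X|-2$. The spectrum is $\operatorname{Sp}(X)=\{d(x,y):x,y\in X\}$. For positive $r\in\operatorname{Sp}(X)$, $G_{r,X}$ is the graph with vertex set $X$ in which $u,v$ are adjacent iff $d(u,v)=r$; $G'_{r,X}$ is the subgraph of $G_{r,X}$ induced by the set of its non-isolated vertices. $K_{1,m}$ is the complete bipartite graph with parts of sizes $1$ and $m$. Diametrical graph: for a finite ultrametric space $X$ with $|X|\ge2$, $G_X$ is the graph with vertex set $X$ in which $u,v$ are adjacent iff $d(u,v)=\operatorname{diam}X$. It is known that $G_X$ is complete $k$-partite for some $k\ge2$, $G_X=G_X[X_1,\dots,X_k]$ (nonempty disjoint parts $X_i$ with union $X$; two vertices are adjacent iff they lie in different parts). Representing tree $T_X$ of a finite nonempty ultrametric space: a labeled rooted tree whose nodes are subsets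 of $X$. The root is $X$, labeled $\operatorname{diam}X$. If $|X|=1$ the tree has only the root, labeled $0$. If $|X|\ge2$ and $G_X=G_X[X_1,\dots,X_k]$, the children of the root are $X_1,\dots,X_k$ with labels $l(X_i)=\operatorname{diam}X_i$. Nodes with label $0$ (one-point sets) are leaves; nodes with positive label are inner nodes, and the construction is repeated for each of them, with that node in place of $X$. The root has level $0$, and a child of a node of level $m$ has level $m+1$. *)

theory Defs
  imports
    "HOL-Analysis.Abstract_Metric_Spaces"
    "HOL-Library.Disjoint_Sets"
    "HOL-Library.FuncSet"
    "Graph_Theory.Graph_Theory"
begin

section \<open>Ultrametric spaces, isometries and the class of spaces under study\<close>

locale Ultrametric_space = Metric_space +
  assumes ultrametric: "\<lbrakk>x \<in> M; y \<in> M; z \<in> M\<rbrakk> \<Longrightarrow> d x y \<le> max (d x z) (d z y)"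

text \<open>
  An isometry is a bijection of the carrier; it is made extensional (undefined outside the
  carrier) so that it is determined by its values on the carrier.
\<close>

definition Iso :: "'a set \<Rightarrow> ('a \<Rightarrow> 'a \<Rightarrow> real) \<Rightarrow> ('a \<Rightarrow> 'a) set" where
  "Iso X d = {g \<in> extensional X. bij_betw g X X \<and> (\<forall>x\<in>X. \<forall>y\<in>X. d (g x) (g y) = d x y)}"

definition Fix :: "'a set \<Rightarrow> ('a \<Rightarrow> 'a) \<Rightarrow> 'a set" where
  "Fix X g = {x \<in> X. g x = x}"

text \<open>
  The equation is stated over the integers, so that the subtraction is not truncated for
  spaces with fewer than two points.
\<close>

definition class_R :: "'a set \<Rightarrow> ('a \<Rightarrow> 'a \<Rightarrow> real) \<Rightarrow> bool" where
  "class_R X d \<longleftrightarrow> finite X \<and> Ultrametric_space X d \<and>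
     int (Min ((\<lambda>g. card (Fix X g)) ` Iso X d)) = int (card X) - 2"

definition Sp :: "'a set \<Rightarrow> ('a \<Rightarrow> 'a \<Rightarrow> real) \<Rightarrow> real set" where
  "Sp X d = {d x y |x y. x \<in> X \<and> y \<in> X}"

definition diam :: "'a set \<Rightarrow> ('a \<Rightarrow> 'a \<Rightarrow> real) \<Rightarrow> real" where
  "diam X d = Sup (Sp X d)"


section \<open>Graphs\<close>

text \<open>
  An undirected graph is a symmetric digraph: an edge between u and v is the pair of arcs
  (u,v) and (v,u).
\<close>

definition dist_graph :: "real \<Rightarrow> 'a set \<Rightarrow> ('a \<Rightarrow> 'a \<Rightarrow> real) \<Rightarrow> ('a, 'a \<times> 'a) pre_digraph" where
  "dist_graph r X d =
     with_proj \<lparr>pverts = X, parcs = {(u, v). u \<in> X \<and> v \<in> X \<and> d u v = r}\<rparr>"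

definition non_isolated :: "('a, 'b) pre_digraph \<Rightarrow> 'a set" where
  "non_isolated G = {u \<in> verts G. \<exists>v \<in> verts G. u \<rightarrow>\<^bsub>G\<^esub> v}"

definition dist_graph' :: "real \<Rightarrow> 'a set \<Rightarrow> ('a \<Rightarrow> 'a \<Rightarrow> real) \<Rightarrow> ('a, 'a \<times> 'a) pre_digraph" where
  "dist_graph' r X d = dist_graph r X d \<restriction> non_isolated (dist_graph r X d)"

definition diametrical_graph :: "'a set \<Rightarrow> ('a \<Rightarrow> 'a \<Rightarrow> real) \<Rightarrow> ('a, 'a \<times> 'a) pre_digraph" where
  "diametrical_graph X d = dist_graph (diam X d) X d"

text \<open>\<open>G = G[X\<^sub>1, \<dots>, X\<^sub>k]\<close> with \<open>k \<ge> 2\<close>, where \<open>P = {X\<^sub>1, \<dots>, X\<^sub>k}\<close>.\<close>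

definition complete_multipartite :: "('a, 'b) pre_digraph \<Rightarrow> 'a set set \<Rightarrow> bool" where
  "complete_multipartite G P \<longleftrightarrow>
     finite P \<and> card P \<ge> 2 \<and> partition_on (verts G) P \<and>
     (\<forall>A\<in>P. \<forall>B\<in>P. \<forall>u\<in>A. \<forall>v\<in>B. u \<rightarrow>\<^bsub>G\<^esub> v \<longleftrightarrow> A \<noteq> B)"

definition complete_bipartite :: "nat \<Rightarrow> nat \<Rightarrow> (nat + nat, (nat + nat) \<times> (nat + nat)) pre_digraph" where
  "complete_bipartite m n =
     (let U = Inl ` {..<m}; V = Inr ` {..<n}
      in with_proj \<lparr>pverts = U \<union> V, parcs = U \<times> V \<union> V \<times> U\<rparr>)"

lemma complete_bipartite_digraph_complete_bipartite:
  "complete_bipartite_digraph m n (complete_bipartite m n)"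
proof -
  let ?U = "Inl ` {..<m} :: (nat + nat) set" and ?V = "Inr ` {..<n} :: (nat + nat) set"
  interpret pair_graph "\<lparr>pverts = ?U \<union> ?V, parcs = ?U \<times> ?V \<union> ?V \<times> ?U\<rparr>"
    by unfold_locales (auto simp: symmetric_def sym_def)
  have "graph (complete_bipartite m n)"
    unfolding complete_bipartite_def Let_def by unfold_locales
  moreover have "card ?U = m" "card ?V = n"
    by (simp_all add: card_image)
  ultimately show ?thesis
    unfolding complete_bipartite_digraph_def
    by (intro conjI exI[of _ ?U] exI[of _ ?V]) (auto simp: complete_bipartite_def Let_def)
qed


section \<open>The representing tree\<close>

abbreviation tree_label :: "('a \<Rightarrow> 'a \<Rightarrow> real) \<Rightarrow> 'a set \<Rightarrow> real" where
  "tree_label d Y \<equiv> diam Y d"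

text \<open>
  \<open>tree_node X d Y m\<close>: \<open>Y\<close> is a node of level \<open>m\<close> of the representing tree of \<open>X\<close>.
  The parts \<open>P\<close> are determined by the diametrical graph.
\<close>

inductive tree_node :: "'a set \<Rightarrow> ('a \<Rightarrow> 'a \<Rightarrow> real) \<Rightarrow> 'a set \<Rightarrow> nat \<Rightarrow> bool"
  for X :: "'a set" and d :: "'a \<Rightarrow> 'a \<Rightarrow> real" where
  root: "tree_node X d X 0"
| child: "\<lbrakk>tree_node X d Y m; tree_label d Y > 0;
           complete_multipartite (diametrical_graph Y d) P; Z \<in> P\<rbrakk>
          \<Longrightarrow> tree_node X d Z (Suc m)"

end

theory Submission
  imports Defs "HOL-Combinatorics.Transposition"
begin

text \<open>
  Both sides of the equivalence say that \<open>X\<close> can be peeled down to one point by repeatedly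
  removing an \<^emph>\<open>apex\<close>: a point at distance equal to the diameter from all the others, which
  are at smaller distance from each other. If every isometry moves at most two points, then only
  one transposition is an isometry; every ball with at least two points contains a closest pair,
  which can be swapped, and this forces an apex at every stage. Conversely, an isometry of a
  space with at least three points fixes its apex. On the tree side, an apex \<open>a\<close> of a node \<open>Y\<close>
  splits it into the children \<open>{a}\<close> and \<open>Y - {a}\<close> and is the centre of a star on \<open>Y\<close>; the
  number of vertices of the star forces all of \<open>Y\<close> to be covered.
\<close>

section \<open>Diameters of finite sets\<close>

lemma dist_le_diam:
  assumes "finite Y" "u \<in> Y" "v \<in> Y"
  shows "d u v \<le> diam Y d"
proof -
  have "Sp Y d = (\<lambda>(x, y). d x y) ` (Y \<times> Y)"
    by (auto simp: Sp_def)
  then show ?thesis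
    unfolding diam_def using assms by (intro cSup_upper) auto
qed

lemma diam_in_Sp:
  assumes "finite Y" "Y \<noteq> {}"
  shows "diam Y d \<in> Sp Y d"
proof -
  have "Sp Y d = (\<lambda>(x, y). d x y) ` (Y \<times> Y)"
    by (auto simp: Sp_def)
  with assms have "finite (Sp Y d)" "Sp Y d \<noteq> {}"
    by auto
  then show ?thesis
    unfolding diam_def by (metis Max_in cSup_eq_Max)
qed

lemma diam_attained:
  assumes "finite Y" "Y \<noteq> {}"
  obtains u v where "u \<in> Y" "v \<in> Y" "d u v = diam Y d"
  using diam_in_Sp[OF assms, of d] by (auto simp: Sp_def)

section \<open>Distance graphs that are stars\<close>

text \<open>The vertex set of the graph G'_{r,X}; despite the name, the centre of a star belongs to
  it as well.\<close>

definition spokes :: "real \<Rightarrow> 'a set \<Rightarrow> ('a \<Rightarrow> 'a \<Rightarrow> real) \<Rightarrow> 'a set" where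
  "spokes r X d = {u \<in> X. \<exists>v \<in> X. d u v = r}"

lemma dist_graph'_simps:
  "verts (dist_graph' r X d) = spokes r X d"
  "arcs (dist_graph' r X d) = {(u, v). u \<in> spokes r X d \<and> v \<in> spokes r X d \<and> d u v = r}"
  "tail (dist_graph' r X d) = fst"
  "head (dist_graph' r X d) = snd"
  by (auto simp: dist_graph'_def dist_graph_def non_isolated_def spokes_def)

lemma complete_bipartite_simps:
  "verts (complete_bipartite m n) = Inl ` {..<m} \<union> Inr ` {..<n}"
  "arcs (complete_bipartite m n) =
     Inl ` {..<m} \<times> Inr ` {..<n} \<union> Inr ` {..<n} \<times> Inl ` {..<m}"
  "tail (complete_bipartite m n) = fst"
  "head (complete_bipartite m n) = snd"
  by (auto simp: complete_bipartite_def Let_def)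

text \<open>Trades graph isomorphism for a condition on distances: in K_{1,m} two vertices are
  adjacent iff exactly one of them is the centre, so a vertex count and a choice of centre
  \<open>c\<close> describe everything.\<close>

lemma digraph_iso_star_iff:
  "digraph_iso (dist_graph' r X d) (complete_bipartite 1 m) \<longleftrightarrow>
     finite (spokes r X d) \<and> card (spokes r X d) = Suc m \<and>
     (\<exists>c \<in> spokes r X d. \<forall>u \<in> spokes r X d. \<forall>v \<in> spokes r X d. d u v = r \<longleftrightarrow> (u = c) \<noteq> (v = c))"
  (is "?iso \<longleftrightarrow> finite ?N \<and> card ?N = Suc m \<and> ?star")
proof
  let ?G = "dist_graph' r X d" and ?H = "complete_bipartite 1 m"
  assume ?iso
  then obtain f where f: "pre_digraph.digraph_isomorphism ?G f" and H: "?H = app_iso f ?G"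
    by (auto simp: digraph_iso_def)
  define h where "h = iso_verts f"
  have inj: "inj_on h ?N"
    using f by (simp add: pre_digraph.digraph_isomorphism_def dist_graph'_simps h_def)
  have tl: "iso_tail f = fst" and hd: "iso_head f = snd"
    using H by (metis complete_bipartite_simps(3,4) tail_app_iso head_app_iso)+
  have img: "h ` ?N = Inl ` {..<1} \<union> Inr ` {..<m}"
    using arg_cong[OF H, of verts]
    by (simp add: complete_bipartite_simps dist_graph'_simps h_def)
  have arc_im: "iso_arcs f ` arcs ?G = arcs ?H"
    using arg_cong[OF H, of arcs] by simp
  \<comment> \<open>Arcs of both graphs are pairs with projections \<open>fst\<close> and
    \<open>snd\<close> as ends, so the arc map of \<open>f\<close> is forced by its vertex
    map.\<close>
  have arc: "iso_arcs f (u, v) = (h u, h v)" if "(u, v) \<in> arcs ?G" for u v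
  proof (rule prod_eqI)
    show "fst (iso_arcs f (u, v)) = fst (h u, h v)"
      using f that tl
      by (force simp: pre_digraph.digraph_isomorphism_def dist_graph'_simps h_def)
    show "snd (iso_arcs f (u, v)) = snd (h u, h v)"
      using f that hd
      by (force simp: pre_digraph.digraph_isomorphism_def dist_graph'_simps h_def)
  qed
  have edge: "d u v = r \<longleftrightarrow> (h u, h v) \<in> arcs ?H" if "u \<in> ?N" "v \<in> ?N" for u v
  proof
    assume "d u v = r"
    with that have "(u, v) \<in> arcs ?G"
      by (simp add: dist_graph'_simps)
    then show "(h u, h v) \<in> arcs ?H"
      using arc arc_im by (metis imageI)
  next
    assume "(h u, h v) \<in> arcs ?H"
    then obtain u' v' where uv': "(u', v') \<in> arcs ?G" "iso_arcs f (u', v') = (h u, h v)"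
      by (metis arc_im imageE surj_pair)
    then have "h u' = h u" "h v' = h v" "u' \<in> ?N" "v' \<in> ?N"
      using arc by (auto simp: dist_graph'_simps)
    with that inj have "u' = u" "v' = v"
      by (auto dest: inj_onD)
    with uv' show "d u v = r"
      by (simp add: dist_graph'_simps)
  qed
  have finH: "finite (h ` ?N)"
    by (simp add: img)
  then have fin: "finite ?N"
    using inj by (rule finite_imageD)
  have "card ?N = card (h ` ?N)"
    using inj by (simp add: card_image)
  also have "\<dots> = Suc m"
    unfolding img by (subst card_Un_disjoint) (auto simp: card_image)
  finally have card: "card ?N = Suc m" .
  have "Inl 0 \<in> h ` ?N"
    by (simp add: img)
  then obtain c where c: "c \<in> ?N" "h c = Inl 0"
    by auto
  have val: "(\<exists>i. i < m \<and> h u = Inr i)" if "u \<in> ?N" "u \<noteq> c" for u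
  proof -
    have "h u \<in> h ` ?N" "h u \<noteq> Inl 0"
      using that c inj_onD[OF inj, of u c] by auto
    then show ?thesis
      unfolding img by auto
  qed
  have ?star
  proof (intro bexI[OF _ c(1)] ballI)
    fix u v assume uv: "u \<in> ?N" "v \<in> ?N"
    show "d u v = r \<longleftrightarrow> (u = c) \<noteq> (v = c)"
      unfolding edge[OF uv] using val[OF uv(1)] val[OF uv(2)] c
      by (cases "u = c"; cases "v = c") (auto simp: complete_bipartite_simps)
  qed
  with fin card show "finite ?N \<and> card ?N = Suc m \<and> ?star"
    by blast
next
  let ?G = "dist_graph' r X d" and ?H = "complete_bipartite 1 m"
  assume asm: "finite ?N \<and> card ?N = Suc m \<and> ?star"
  then obtain c where c: "c \<in> ?N"
    and star: "\<And>u v. u \<in> ?N \<Longrightarrow> v \<in> ?N \<Longrightarrow> d u v = r \<longleftrightarrow> (u = c) \<noteq> (v = c)"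
    by blast
  have "card (?N - {c}) = m"
    using asm c by simp
  then obtain k where k: "bij_betw k (?N - {c}) {..<m}"
    using asm by (metis finite_Diff finite_same_card_bij finite_lessThan card_lessThan)
  define h where "h u = (if u = c then Inl 0 else Inr (k u) :: nat + nat)" for u
  define f where
    "f = \<lparr>iso_verts = h, iso_arcs = map_prod h h, iso_head = snd, iso_tail = fst\<rparr>"
  have inj: "inj_on h ?N"
    using k by (auto simp: inj_on_def h_def bij_betw_def)
  have "h ` (?N - {c}) = Inr ` k ` (?N - {c})"
    unfolding image_image by (rule image_cong) (auto simp: h_def)
  then have rest: "h ` (?N - {c}) = Inr ` {..<m}"
    using bij_betw_imp_surj_on[OF k] by simp
  have hc: "h c = Inl 0"
    by (simp add: h_def)
  have img: "h ` ?N = {Inl 0} \<union> Inr ` {..<m}"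
    using rest hc c by (metis insert_Diff image_insert insert_is_Un)
  have arcs: "arcs ?G = {c} \<times> (?N - {c}) \<union> (?N - {c}) \<times> {c}"
    using star c by (auto simp: dist_graph'_simps)
  have arcs_img: "map_prod h h ` arcs ?G = arcs ?H"
    unfolding arcs image_Un map_prod_surj_on[OF refl refl]
    by (simp add: rest hc complete_bipartite_simps lessThan_Suc)
  have "pre_digraph.digraph_isomorphism ?G f"
    unfolding pre_digraph.digraph_isomorphism_def f_def
    using inj by (auto simp: dist_graph'_simps wf_digraph_def inj_on_def)
  moreover have "?H = app_iso f ?G"
    using arcs_img img
    by (intro pre_digraph.equality)
      (auto simp: f_def dist_graph'_simps(1) complete_bipartite_simps)
  ultimately show ?iso
    unfolding digraph_iso_def by blast
qed

lemma tree_node_subset: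
  assumes "tree_node X d Y p" "X \<noteq> {}"
  shows "Y \<subseteq> X \<and> Y \<noteq> {}"
  using assms(1)
proof induction
  case (child Y m P Z)
  then have "partition_on Y P"
    by (simp add: complete_multipartite_def diametrical_graph_def dist_graph_def)
  with child show ?case
    by (auto simp: partition_on_def)
qed (use assms(2) in simp)

section \<open>Twins, apexes and combs\<close>

text \<open>In a metric space this is precisely the condition for the swap of \<open>x\<close> and
  \<open>y\<close>, fixing all other points, to be an isometry of \<open>Y\<close>.\<close>

definition twins :: "('a \<Rightarrow> 'a \<Rightarrow> real) \<Rightarrow> 'a set \<Rightarrow> 'a \<Rightarrow> 'a \<Rightarrow> bool" where
  "twins d Y x y \<longleftrightarrow> x \<in> Y \<and> y \<in> Y \<and> x \<noteq> y \<and> (\<forall>z \<in> Y - {x, y}. d x z = d y z)"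

lemma twinsD:
  assumes "twins d Y x y"
  shows "x \<in> Y" "y \<in> Y" "x \<noteq> y"
  using assms by (simp_all add: twins_def)

text \<open>The condition \<open>Y \<noteq> {a}\<close> rules out one-point sets, where both
  distance conditions are vacuous.\<close>

definition apex :: "('a \<Rightarrow> 'a \<Rightarrow> real) \<Rightarrow> 'a set \<Rightarrow> 'a \<Rightarrow> bool" where
  "apex d Y a \<longleftrightarrow> a \<in> Y \<and> Y \<noteq> {a} \<and> (\<forall>z \<in> Y - {a}. d a z = diam Y d) \<and>
     (\<forall>u \<in> Y - {a}. \<forall>v \<in> Y - {a}. d u v < diam Y d)"

text \<open>In terms of the representing tree, a caterpillar: each inner node has as children a leaf
  and one further node, again a comb.\<close>

inductive comb :: "('a \<Rightarrow> 'a \<Rightarrow> real) \<Rightarrow> 'a set \<Rightarrow> bool" for d where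
  singleton: "comb d {a}"
| peel: "apex d Y a \<Longrightarrow> comb d (Y - {a}) \<Longrightarrow> comb d Y"

section \<open>Isometries and the points they move\<close>

text \<open>Drops the extensionality built into \<open>Iso\<close>, so that transpositions and
  compositions qualify as they stand.\<close>

definition isometry_on :: "('a \<Rightarrow> 'a \<Rightarrow> real) \<Rightarrow> 'a set \<Rightarrow> ('a \<Rightarrow> 'a) \<Rightarrow> bool" where
  "isometry_on d Y g \<longleftrightarrow> bij_betw g Y Y \<and> (\<forall>x \<in> Y. \<forall>y \<in> Y. d (g x) (g y) = d x y)"

lemma isometry_on_comp:
  "isometry_on d Y f \<Longrightarrow> isometry_on d Y g \<Longrightarrow> isometry_on d Y (g \<circ> f)"
  by (auto simp: isometry_on_def intro: bij_betw_trans dest: bij_betwE)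

lemma restrict_in_Iso:
  assumes "isometry_on d Y g"
  shows "restrict g Y \<in> Iso Y d"
  using assms by (simp add: Iso_def isometry_on_def)

lemma Fix_restrict: "Fix Y (restrict g Y) = Fix Y g"
  by (auto simp: Fix_def)

lemma card_Fix_add_card_moved:
  assumes "finite Y"
  shows "card (Fix Y g) + card {x \<in> Y. g x \<noteq> x} = card Y"
proof -
  have "Y = Fix Y g \<union> {x \<in> Y. g x \<noteq> x}" "Fix Y g \<inter> {x \<in> Y. g x \<noteq> x} = {}"
    by (auto simp: Fix_def)
  with assms show ?thesis
    by (metis card_Un_disjoint finite_Un)
qed

lemma finite_Iso:
  assumes "finite Y"
  shows "finite (Iso Y d)"
proof (rule finite_subset)
  show "Iso Y d \<subseteq> Y \<rightarrow>\<^sub>E Y"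
    by (auto simp: Iso_def PiE_def dest: bij_betwE)
qed (use assms in \<open>auto intro: finite_PiE\<close>)

text \<open>Counts moved instead of fixed points: the two numbers add up to \<open>card X\<close>,
  so a least number \<open>card X - 2\<close> of fixed points is a greatest number 2 of moved
  ones.\<close>

lemma class_R_iff:
  assumes X: "Ultrametric_space X d" "finite X" "card X \<ge> 2"
  shows "class_R X d \<longleftrightarrow>
    (\<forall>g. isometry_on d X g \<longrightarrow> card {x \<in> X. g x \<noteq> x} \<le> 2) \<and>
    (\<exists>g. isometry_on d X g \<and> card {x \<in> X. g x \<noteq> x} = 2)"
proof -
  let ?F = "(\<lambda>g. card (Fix X g)) ` Iso X d"
  have F: "?F = {card (Fix X g) | g. isometry_on d X g}"
  proof safe
    fix g assume "isometry_on d X g"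
    then show "card (Fix X g) \<in> ?F"
      using restrict_in_Iso Fix_restrict by (metis imageI)
  qed (auto simp: Iso_def isometry_on_def)
  have "isometry_on d X id"
    by (simp add: isometry_on_def)
  then have "?F \<noteq> {}"
    unfolding F by blast
  moreover have "finite ?F"
    using finite_Iso[OF X(2)] by (rule finite_imageI)
  ultimately have "Min ?F = card X - 2 \<longleftrightarrow> card X - 2 \<in> ?F \<and> (\<forall>k \<in> ?F. card X - 2 \<le> k)"
    by (auto simp: Min_eq_iff)
  also have "\<dots> \<longleftrightarrow> (\<exists>g. isometry_on d X g \<and> card X - 2 = card (Fix X g)) \<and>
      (\<forall>g. isometry_on d X g \<longrightarrow> card X - 2 \<le> card (Fix X g))"
    unfolding F by blast
  also have "\<dots> \<longleftrightarrow> (\<exists>g. isometry_on d X g \<and> card {x \<in> X. g x \<noteq> x} = 2) \<and>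
      (\<forall>g. isometry_on d X g \<longrightarrow> card {x \<in> X. g x \<noteq> x} \<le> 2)"
  proof -
    \<comment> \<open>The bound \<open>card X \<ge> 2\<close> keeps the subtraction of natural
      numbers exact.\<close>
    have "(card X - 2 = card (Fix X g)) = (card {x \<in> X. g x \<noteq> x} = 2)"
      "(card X - 2 \<le> card (Fix X g)) = (card {x \<in> X. g x \<noteq> x} \<le> 2)" for g
      using card_Fix_add_card_moved[OF X(2), of g] X(3) by linarith+
    then show ?thesis
      by simp
  qed
  finally have "Min ?F = card X - 2 \<longleftrightarrow> \<dots>" .
  moreover have "class_R X d \<longleftrightarrow> Min ?F = card X - 2"
    using X by (auto simp: class_R_def)
  ultimately show ?thesis
    by blast
qed

section \<open>Twins in ultrametric spaces\<close>

context Ultrametric_space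
begin

text \<open>The two longest sides of an ultrametric triangle are equal: \<open>d x z\<close> and
  \<open>d y z\<close> bound each other, because \<open>d x y\<close> is too short to be the maximum
  in either inequality.\<close>

lemma isosceles:
  assumes "x \<in> M" "y \<in> M" "z \<in> M" "d x y < d y z"
  shows "d x z = d y z"
  using ultrametric[of x z y] ultrametric[of y z x] assms commute[of x y] by linarith

lemma twins_isometry_on:
  assumes "Y \<subseteq> M" "twins d Y x y"
  shows "isometry_on d Y (Transposition.transpose x y)"
proof -
  have "x \<in> M" "y \<in> M"
    using assms by (auto simp: twins_def)
  then have xx: "d x x = 0" "d y y = 0"
    by simp_all
  have eq: "d x z = d y z" "d z x = d z y" if "z \<in> Y" "z \<noteq> x" "z \<noteq> y" for z
  proof -
    show "d x z = d y z"
      using assms(2) that unfolding twins_def by blast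
    then show "d z x = d z y"
      by (subst (1 2) commute)
  qed
  have "bij_betw (Transposition.transpose x y) Y Y"
    using twinsD[OF assms(2)]
    by (intro bij_betw_byWitness[where f' = "Transposition.transpose x y"])
      (auto simp: Transposition.transpose_def)
  moreover have "d (Transposition.transpose x y u) (Transposition.transpose x y v) = d u v"
    if "u \<in> Y" "v \<in> Y" for u v
    using that xx eq commute transpose_apply_first[of x y] transpose_apply_second[of x y]
      transpose_apply_other[of _ x y] by metis
  ultimately show ?thesis
    by (simp add: isometry_on_def)
qed

lemma moved_transpose:
  assumes "x \<in> Y" "y \<in> Y" "x \<noteq> y"
  shows "{z \<in> Y. Transposition.transpose x y z \<noteq> z} = {x, y}"
  using assms by (auto simp: Transposition.transpose_def)

text \<open>
  Two different twin transpositions compose to an isometry moving four points, or three if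
  they overlap.
\<close>

lemma twins_unique:
  assumes "Y \<subseteq> M" "finite Y"
    and R: "\<And>g. isometry_on d Y g \<Longrightarrow> card {x \<in> Y. g x \<noteq> x} \<le> 2"
    and tw: "twins d Y x y" "twins d Y x' y'"
  shows "{x, y} = {x', y'}"
proof -
  have False if tw: "twins d Y x y" "twins d Y x' y'" and x': "x' \<notin> {x, y}" for x y x' y'
  proof -
    let ?g = "Transposition.transpose x y \<circ> Transposition.transpose x' y'"
    note D = twinsD[OF tw(1)] twinsD[OF tw(2)]
    \<comment> \<open>This \<open>w\<close> differs from \<open>x'\<close> too, since
      \<open>x' \<notin> {x, y}\<close>; the inner transposition fixes it and the outer one moves
      it.\<close>
    obtain w where w: "w \<in> {x, y}" "w \<noteq> y'"
      using D(3) by blast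
    have "isometry_on d Y ?g"
      using tw assms(1) by (intro isometry_on_comp twins_isometry_on)
    then have le: "card {z \<in> Y. ?g z \<noteq> z} \<le> 2"
      by (rule R)
    have "{x', y', w} \<subseteq> {z \<in> Y. ?g z \<noteq> z}"
      using D w x' by (auto simp: Transposition.transpose_def)
    moreover have "card {x', y', w} = 3"
      using D w x' by auto
    ultimately show False
      using le card_mono[of "{z \<in> Y. ?g z \<noteq> z}" "{x', y', w}"] assms(2) by simp
  qed
  moreover have "twins d Y y' x'"
    using tw(2) unfolding twins_def insert_commute[of y' x'] by metis
  ultimately have "x' \<in> {x, y}" "y' \<in> {x, y}" "x' \<noteq> y'"
    using tw twinsD(3)[OF tw(2)] by blast+
  then show ?thesis
    by auto
qed

text \<open>A closest pair of distinct points in \<open>B\<close> works: for \<open>z\<close> in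
  \<open>B\<close>, neither \<open>d p z\<close> nor \<open>d q z\<close> is below
  \<open>d p q\<close>, so each bounds the other; for \<open>z\<close> outside \<open>B\<close>,
  equality is the hypothesis \<open>outside\<close>.\<close>

lemma exists_twins:
  assumes Y: "Y \<subseteq> M" "finite Y" and B: "B \<subseteq> Y" "u \<in> B" "v \<in> B" "u \<noteq> v"
    and outside: "\<And>x y z. x \<in> B \<Longrightarrow> y \<in> B \<Longrightarrow> z \<in> Y - B \<Longrightarrow> d x z = d y z"
  obtains p q where "p \<in> B" "q \<in> B" "twins d Y p q"
proof -
  let ?S = "{(x, y) \<in> B \<times> B. x \<noteq> y}" and ?D = "\<lambda>(x, y). d x y"
  have fin: "finite ?S"
    using Y(2) B(1) by (auto intro: finite_subset[of _ "B \<times> B"] finite_subset)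
  have ne: "?S \<noteq> {}"
    using B by blast
  obtain s where s: "s \<in> ?S" "\<And>t. t \<in> ?S \<Longrightarrow> ?D s \<le> ?D t"
    using that[OF arg_min_if_finite(1)[OF fin ne] arg_min_least[OF fin ne]] .
  obtain p q where pq: "s = (p, q)"
    by (cases s)
  have min: "d p q \<le> d x y" if "x \<in> B" "y \<in> B" "x \<noteq> y" for x y
    using s(2)[of "(x, y)"] that pq by simp
  have "d p z = d q z" if z: "z \<in> Y - {p, q}" for z
  proof (cases "z \<in> B")
    case True
    have "p \<in> B" "q \<in> B"
      using s pq by auto
    with True z have "d p q \<le> d p z" "d p q \<le> d q z"
      using min by auto
    moreover have "d p z \<le> max (d p q) (d q z)" "d q z \<le> max (d q p) (d p z)"
      using \<open>p \<in> B\<close> \<open>q \<in> B\<close> True B(1) Y(1) by (auto intro!: ultrametric)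
    ultimately show ?thesis
      using commute[of p q] by linarith
  next
    case False
    with z show ?thesis
      using s pq by (intro outside) auto
  qed
  with s pq B(1) have "twins d Y p q"
    by (auto simp: twins_def)
  with s pq show ?thesis
    using that by auto
qed

text \<open>An open ball meets the hypothesis \<open>outside\<close> of \<open>exists_twins\<close>:
  by \<open>isosceles\<close>, all its points have the same distance to a given outer point.\<close>

lemma exists_twins_in_ball:
  assumes Y: "Y \<subseteq> M" "finite Y" and xy: "x \<in> Y" "y \<in> Y" "x \<noteq> y" "d x y < r"
  obtains p q where "d x p < r" "d x q < r" "twins d Y p q"
proof -
  let ?B = "{w \<in> Y. d x w < r}"
  note found = that
  have "0 < r"
    using nonneg[of x y] xy by linarith
  then have x: "x \<in> ?B"
    using xy Y by auto
  have eq: "d u z = d x z" if "u \<in> ?B" "z \<in> Y - ?B" for u z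
    using that xy Y commute[of u x] by (intro isosceles) auto
  show ?thesis
  proof (rule exists_twins[OF Y, of ?B x y])
    show "d u z = d v z" if "u \<in> ?B" "v \<in> ?B" "z \<in> Y - ?B" for u v z
      using eq[OF that(1,3)] eq[OF that(2,3)] by (rule trans[OF _ sym])
    show thesis if "p \<in> ?B" "q \<in> ?B" "twins d Y p q" for p q
      using that by (intro found[of p q]) simp_all
  qed (use x xy in simp_all)
qed

section \<open>From unique twins to combs\<close>

lemma apex_diam_less:
  assumes "apex d Y a" "finite Y"
  shows "diam (Y - {a}) d < diam Y d"
proof -
  have "Y - {a} \<noteq> {}"
    using assms by (auto simp: apex_def)
  then obtain u v where "u \<in> Y - {a}" "v \<in> Y - {a}" "d u v = diam (Y - {a}) d"
    using diam_attained assms(2) by (metis finite_Diff)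
  then show ?thesis
    using assms(1) by (metis apex_def)
qed

text \<open>Every open ball of radius \<open>diam Y d\<close> with at least two points contains
  twins, so two disjoint such balls contradict uniqueness. This yields a point far from all others,
  and uniqueness again excludes a second one unless \<open>Y\<close> has only two points.\<close>

lemma exists_apex:
  assumes Y: "Y \<subseteq> M" "finite Y" "s \<in> Y" "t \<in> Y" "s \<noteq> t"
    and uniq: "\<And>x y x' y'. twins d Y x y \<Longrightarrow> twins d Y x' y' \<Longrightarrow> {x, y} = {x', y'}"
  obtains a where "apex d Y a"
proof -
  let ?r = "diam Y d"
  have le: "d x y \<le> ?r" if "x \<in> Y" "y \<in> Y" for x y
    using dist_le_diam Y(2) that .
  have "0 < d s t"
    using mdist_pos_less Y by blast
  then have r: "0 < ?r"
    using le[OF Y(3,4)] by linarith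
  \<comment> \<open>Open balls of radius \<open>?r\<close> about points at distance
    \<open>?r\<close> are disjoint.\<close>
  have far: "?r \<le> d u p" if "d v p < ?r" "d u v = ?r" "u \<in> Y" "v \<in> Y" "p \<in> Y" for u v p
  proof -
    have "u \<in> M" "v \<in> M" "p \<in> M"
      using that Y(1) by auto
    then show ?thesis
      using ultrametric[of u v p] that commute[of p v] by linarith
  qed
  \<comment> \<open>A lone point is an open ball of radius \<open>?r\<close> by itself.\<close>
  define lone where "lone x \<longleftrightarrow> (\<forall>y \<in> Y - {x}. d x y = ?r)" for x
  have ball: "\<exists>p q. d x p < ?r \<and> d x q < ?r \<and> twins d Y p q" if x: "x \<in> Y" "\<not> lone x" for x
  proof -
    obtain y where "y \<in> Y" "y \<noteq> x" "d x y \<noteq> ?r"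
      using x(2) unfolding lone_def by blast
    moreover from this have "d x y < ?r"
      using le[OF x(1)] by (simp add: order.strict_iff_order)
    ultimately show ?thesis
      using exists_twins_in_ball[OF Y(1,2) x(1), of y ?r] by metis
  qed
  have lone_or: "lone x \<or> lone y" if xy: "x \<in> Y" "y \<in> Y" "d x y = ?r" for x y
  proof (rule ccontr)
    assume "\<not> (lone x \<or> lone y)"
    then obtain p q p' q' where tw: "d x p < ?r" "d x q < ?r" "twins d Y p q"
      "d y p' < ?r" "d y q' < ?r" "twins d Y p' q'"
      using ball xy by meson
    then have "?r \<le> d x p'" "?r \<le> d x q'"
      using far xy twinsD(1,2)[OF tw(6)] by auto
    moreover have "{p, q} = {p', q'}"
      using uniq tw by blast
    ultimately show False
      using tw by auto
  qed
  have lone_twins: "twins d Y x y" if "x \<in> Y" "y \<in> Y" "x \<noteq> y" "lone x" "lone y" for x y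
    using that by (auto simp: twins_def lone_def)
  \<comment> \<open>Two lone points are twins; a third point supplies another pair, either together
    with \<open>x\<close> or inside its own ball, which misses \<open>x\<close> and
    \<open>y\<close>.\<close>
  have no_pair: False if xyz: "x \<in> Y" "y \<in> Y" "z \<in> Y" "x \<noteq> y" "y \<noteq> z" "z \<noteq> x" "lone x" "lone y" for x y z
  proof (cases "lone z")
    case True
    then have "twins d Y x z" "twins d Y x y"
      using xyz lone_twins by auto
    then show False
      using uniq xyz by (metis doubleton_eq_iff)
  next
    case False
    then obtain p q where pq: "d z p < ?r" "d z q < ?r" "twins d Y p q"
      using ball xyz by meson
    then have "{p, q} = {x, y}"
      using lone_twins uniq xyz by meson
    moreover have "d z x = ?r" "d z y = ?r"
      using xyz commute by (auto simp: lone_def)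
    ultimately show False
      using pq by (auto simp: doubleton_eq_iff)
  qed
  obtain u v where uv: "u \<in> Y" "v \<in> Y" "d u v = ?r"
    using diam_attained Y by (metis empty_iff)
  then obtain a where a: "a \<in> Y" "lone a"
    using lone_or by blast
  \<comment> \<open>A diametral pair avoiding \<open>a\<close> would contain a second lone point,
    its other member being the third point for \<open>no_pair\<close>.\<close>
  have "d x y < ?r" if xy: "x \<in> Y - {a}" "y \<in> Y - {a}" for x y
  proof (rule ccontr)
    assume "\<not> d x y < ?r"
    then have eq: "d x y = ?r"
      using le[of x y] xy by auto
    then have "x \<noteq> y"
      using r xy Y(1) by auto
    moreover have "lone x \<or> lone y"
      using eq lone_or xy by blast
    ultimately show False
      using no_pair[of a x y] no_pair[of a y x] a xy by auto
  qed
  with a Y have "apex d Y a"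
    by (auto simp: apex_def lone_def)
  then show ?thesis
    by (rule that)
qed

text \<open>Removing the apex \<open>a\<close> creates no new twins, because all remaining points
  have the same distance from \<open>a\<close>; uniqueness thus passes to
  \<open>Y - {a}\<close>.\<close>

lemma comb_if_twins_unique:
  assumes "Y \<subseteq> M" "finite Y" "Y \<noteq> {}"
    and "\<And>x y x' y'. twins d Y x y \<Longrightarrow> twins d Y x' y' \<Longrightarrow> {x, y} = {x', y'}"
  shows "comb d Y"
  using assms
proof (induction "card Y" arbitrary: Y)
  case 0
  then show ?case by simp
next
  case (Suc k)
  show ?case
  proof (cases "\<exists>s. Y = {s}")
    case True
    then show ?thesis
      by (auto intro: comb.singleton)
  next
    case False
    with Suc.prems(3) obtain s t where "s \<in> Y" "t \<in> Y" "s \<noteq> t"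
      by blast
    then obtain a where a: "apex d Y a"
      by (rule exists_apex[OF Suc.prems(1,2) _ _ _ Suc.prems(4)])
    then have a': "a \<in> Y" "Y - {a} \<noteq> {}"
      by (auto simp: apex_def)
    have lift: "twins d Y x y" if "twins d (Y - {a}) x y" for x y
    proof -
      have "d x a = d y a"
      proof -
        have "x \<in> Y - {a}" "y \<in> Y - {a}"
          using twinsD[OF that] by auto
        then have "d a x = d a y"
          using a by (simp add: apex_def)
        then show ?thesis
          by (subst (1 2) commute)
      qed
      with that show ?thesis
        unfolding twins_def by blast
    qed
    have "comb d (Y - {a})"
    proof (rule Suc.hyps(1))
      show "{x, y} = {x', y'}" if "twins d (Y - {a}) x y" "twins d (Y - {a}) x' y'" for x y x' y'
        using lift that Suc.prems(4) by blast
    qed (use Suc.hyps(2) Suc.prems a' in auto)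
    with a show ?thesis
      by (rule comb.peel)
  qed
qed

section \<open>Isometries of combs\<close>

text \<open>With at least three points the apex is fixed, so the isometry restricts to
  \<open>Y - {a}\<close> and induction applies. Two points may be swapped, but then the bound is
  just the cardinality.\<close>

lemma comb_isometry_moves_le_2:
  assumes "comb d Y" "Y \<subseteq> M" "finite Y" "isometry_on d Y g"
  shows "card {x \<in> Y. g x \<noteq> x} \<le> 2"
  using assms
proof (induction rule: comb.induct)
  case (singleton a)
  have "card {x \<in> {a}. g x \<noteq> x} \<le> card {a}"
    by (rule card_mono) auto
  then show ?case
    by simp
next
  case (peel Y a)
  note Y = \<open>Y \<subseteq> M\<close> \<open>finite Y\<close>
  have bij: "bij_betw g Y Y" and iso: "\<And>x y. x \<in> Y \<Longrightarrow> y \<in> Y \<Longrightarrow> d (g x) (g y) = d x y"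
    using \<open>isometry_on d Y g\<close> by (auto simp: isometry_on_def)
  have a: "a \<in> Y" and da: "\<And>z. z \<in> Y \<Longrightarrow> z \<noteq> a \<Longrightarrow> d a z = diam Y d"
    and lt: "\<And>u v. u \<in> Y \<Longrightarrow> v \<in> Y \<Longrightarrow> u \<noteq> a \<Longrightarrow> v \<noteq> a \<Longrightarrow> d u v < diam Y d"
    using \<open>apex d Y a\<close> by (auto simp: apex_def)
  show ?case
  proof (cases "card Y \<le> 2")
    case True
    have "card {x \<in> Y. g x \<noteq> x} \<le> card Y"
      using Y by (intro card_mono) auto
    with True show ?thesis
      by simp
  next
    case False
    have "g a = a"
    proof (rule ccontr)
      assume "g a \<noteq> a"
      have "card {a, g a} \<le> 2"
        by (simp add: card_insert_if)
      then have "\<not> Y \<subseteq> {a, g a}"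
        using False card_mono[of "{a, g a}" Y] by auto
      \<comment> \<open>This third point is the image of some \<open>b \<noteq> a\<close>: as
        \<open>d a b\<close> is the diameter, so is \<open>d (g a) c\<close>, yet \<open>g a\<close>
        and \<open>c\<close> both differ from \<open>a\<close>.\<close>
      then obtain c where c: "c \<in> Y" "c \<noteq> a" "c \<noteq> g a"
        by auto
      then obtain b where b: "b \<in> Y" "g b = c"
        using bij by (metis bij_betw_imp_surj_on imageE)
      then have "b \<noteq> a"
        using c by auto
      then have "d (g a) (g b) = diam Y d"
        using iso[of a b] a b da[of b] by simp
      moreover have "g a \<in> Y"
        using a bij by (auto dest: bij_betwE)
      ultimately show False
        using lt[of "g a" c] b c \<open>g a \<noteq> a\<close> by simp
    qed
    then have "bij_betw g (Y - {a}) (Y - {a})"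
      using bij_betw_DiffI[OF bij, of "{a}" "{a}"] a by simp
    then have "isometry_on d (Y - {a}) g"
      using iso by (simp add: isometry_on_def)
    then have "card {x \<in> Y - {a}. g x \<noteq> x} \<le> 2"
      using peel.IH Y by blast
    moreover have "{x \<in> Y. g x \<noteq> x} = {x \<in> Y - {a}. g x \<noteq> x}"
      using \<open>g a = a\<close> by auto
    ultimately show ?thesis
      by simp
  qed
qed

text \<open>A closest pair of the whole space always gives an isometry moving exactly two points, so
  membership in the class only asks that no isometry moves more.\<close>

lemma class_R_iff_comb:
  assumes fin: "finite M" and card: "card M \<ge> 2"
  shows "class_R M d \<longleftrightarrow> comb d M"
proof -
  have us: "Ultrametric_space M d"
    by unfold_locales
  obtain s t where st: "s \<in> M" "t \<in> M" "s \<noteq> t"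
    using card by (metis card_2_iff' ex_card subsetD)
  then obtain p q where pq: "twins d M p q"
    using exists_twins[OF order.refl fin order.refl] by blast
  have "isometry_on d M (Transposition.transpose p q)"
    using pq by (intro twins_isometry_on) auto
  moreover have "card {z \<in> M. Transposition.transpose p q z \<noteq> z} = 2"
    using pq by (subst moved_transpose) (auto dest: twinsD)
  ultimately have "class_R M d \<longleftrightarrow> (\<forall>g. isometry_on d M g \<longrightarrow> card {x \<in> M. g x \<noteq> x} \<le> 2)"
    using class_R_iff[OF us fin card] by blast
  also have "\<dots> \<longleftrightarrow> comb d M"
  proof
    assume "\<forall>g. isometry_on d M g \<longrightarrow> card {x \<in> M. g x \<noteq> x} \<le> 2"
    then have "{x, y} = {x', y'}" if "twins d M x y" "twins d M x' y'" for x y x' y'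
      using that by (intro twins_unique[OF order.refl fin]) blast
    then show "comb d M"
      using st(1) by (intro comb_if_twins_unique[OF order.refl fin]) blast+
  next
    assume "comb d M"
    then show "\<forall>g. isometry_on d M g \<longrightarrow> card {x \<in> M. g x \<noteq> x} \<le> 2"
      using comb_isometry_moves_le_2 fin by blast
  qed
  finally show ?thesis .
qed

section \<open>Nodes of the representing tree and their stars\<close>

text \<open>By strictness no pair of distinct points reaching outside \<open>Y\<close> has distance
  \<open>diam Y d\<close>; if this is positive, the edges of the distance graph at that radius lie
  inside \<open>Y\<close>.\<close>

definition isolated_node :: "'a set \<Rightarrow> bool" where
  "isolated_node Y \<longleftrightarrow> Y \<subseteq> M \<and> Y \<noteq> {} \<and> (\<forall>u \<in> M - Y. \<forall>v \<in> M. u \<noteq> v \<longrightarrow> diam Y d < d u v)"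

text \<open>A pair not inside \<open>Y - {a}\<close> either contains \<open>a\<close> and lies in
  \<open>Y\<close>, with distance \<open>diam Y d\<close>, or leaves \<open>Y\<close>, with larger
  distance; by \<open>apex_diam_less\<close> both exceed the new diameter.\<close>

lemma isolated_node_apex:
  assumes "isolated_node Y" "apex d Y a" "finite M"
  shows "isolated_node (Y - {a})"
proof -
  have fin: "finite Y" and sub: "Y \<subseteq> M"
    using assms by (auto simp: isolated_node_def intro: finite_subset)
  have less: "diam (Y - {a}) d < diam Y d"
    using assms fin by (intro apex_diam_less)
  have "diam (Y - {a}) d < d u v" if uv: "u \<in> M - (Y - {a})" "v \<in> M" "u \<noteq> v" for u v
  proof (cases "u \<in> Y \<and> v \<in> Y")
    case True
    with uv have "d u v = diam Y d"
      using assms(2) by (auto simp: apex_def)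
    with less show ?thesis
      by simp
  next
    case False
    with uv have "diam Y d < d u v \<or> diam Y d < d v u"
      using assms(1) by (auto simp: isolated_node_def)
    with less show ?thesis
      using commute[of u v] by linarith
  qed
  with sub assms(2) show ?thesis
    by (auto simp: isolated_node_def apex_def)
qed

lemma spokes_subset:
  assumes "isolated_node Y" "diam Y d > 0"
  shows "spokes (diam Y d) M d \<subseteq> Y"
proof
  fix u assume "u \<in> spokes (diam Y d) M d"
  then obtain v where "u \<in> M" "v \<in> M" "d u v = diam Y d"
    by (auto simp: spokes_def)
  moreover from this have "u \<noteq> v"
    using assms(2) by auto
  ultimately show "u \<in> Y"
    using assms(1) by (force simp: isolated_node_def)
qed

lemma diam_pos_iff:
  assumes "Y \<subseteq> M" "finite Y" "Y \<noteq> {}"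
  shows "diam Y d > 0 \<longleftrightarrow> card Y \<ge> 2"
proof
  assume "diam Y d > 0"
  then obtain u v where "u \<in> Y" "v \<in> Y" "d u v > 0"
    using diam_attained assms by metis
  then have "{u, v} \<subseteq> Y" "u \<noteq> v"
    using assms by auto
  then show "card Y \<ge> 2"
    using card_mono[OF assms(2), of "{u, v}"] by simp
next
  assume "card Y \<ge> 2"
  then obtain s t where st: "s \<in> Y" "t \<in> Y" "s \<noteq> t"
    by (metis card_2_iff' ex_card subsetD)
  then have "0 < d s t"
    using assms(1) mdist_pos_less by blast
  with dist_le_diam[OF assms(2) st(1,2), of d] show "diam Y d > 0"
    by linarith
qed

text \<open>The star has \<open>card Y\<close> vertices, all in \<open>Y\<close> by
  \<open>spokes_subset\<close>; so it spans \<open>Y\<close> and its centre is an apex. Conversely,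
  the edges from an apex already make every point of \<open>Y\<close> non-isolated.\<close>

lemma star_iff_apex:
  assumes "isolated_node Y" "finite M" "card Y = Suc m" "m > 0"
  shows "digraph_iso (dist_graph' (diam Y d) M d) (complete_bipartite 1 m) \<longleftrightarrow> (\<exists>a. apex d Y a)"
proof -
  let ?N = "spokes (diam Y d) M d"
  have sub: "Y \<subseteq> M" and ne: "Y \<noteq> {}" and fin: "finite Y"
    using assms by (auto simp: isolated_node_def intro: finite_subset)
  have pos: "diam Y d > 0"
    using diam_pos_iff[OF sub fin ne] assms by simp
  have NY: "?N \<subseteq> Y"
    using assms(1) pos by (rule spokes_subset)
  show ?thesis
  proof
    assume "digraph_iso (dist_graph' (diam Y d) M d) (complete_bipartite 1 m)"
    then obtain c where N: "card ?N = Suc m" and c: "c \<in> ?N"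
      and star: "\<And>u v. u \<in> ?N \<Longrightarrow> v \<in> ?N \<Longrightarrow> d u v = diam Y d \<longleftrightarrow> (u = c) \<noteq> (v = c)"
      unfolding digraph_iso_star_iff by blast
    have "?N = Y"
      using NY fin N assms(3) by (simp add: card_subset_eq)
    moreover have "Y \<noteq> {c}"
      using assms(3,4) by auto
    moreover have "d u v \<le> diam Y d" if "u \<in> Y" "v \<in> Y" for u v
      using dist_le_diam fin that .
    ultimately have "apex d Y c"
      using c star unfolding apex_def by (auto simp: order.strict_iff_order)
    then show "\<exists>a. apex d Y a" ..
  next
    assume "\<exists>a. apex d Y a"
    then obtain a where a: "apex d Y a" ..
    then have far: "d a z = diam Y d" "d z a = diam Y d" if "z \<in> Y" "z \<noteq> a" for z
      using that commute by (auto simp: apex_def)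
    have star: "d u v = diam Y d \<longleftrightarrow> (u = a) \<noteq> (v = a)" if "u \<in> Y" "v \<in> Y" for u v
    proof (cases "u = a \<or> v = a")
      case True
      with that sub pos show ?thesis
        using far[of u] far[of v] by auto
    next
      case False
      with that a have "d u v < diam Y d"
        by (simp add: apex_def)
      with False show ?thesis
        by simp
    qed
    have aY: "a \<in> Y" "Y \<noteq> {a}"
      using a by (auto simp: apex_def)
    then obtain b where "b \<in> Y" "b \<noteq> a"
      by blast
    then have "Y \<subseteq> ?N"
      using far aY sub unfolding spokes_def by blast
    with NY have "?N = Y"
      by blast
    then show "digraph_iso (dist_graph' (diam Y d) M d) (complete_bipartite 1 m)"
      unfolding digraph_iso_star_iff using assms(3) fin star aY by auto
  qed
qed

text \<open>Adjacent pairs are those with exactly one member equal to \<open>a\<close>, so parts,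
  being classes of non-adjacency, can only be \<open>{a}\<close> and the rest. This pins down
  \<open>P\<close> in the rule \<open>tree_node.child\<close>.\<close>

lemma diametrical_graph_multipartite_iff:
  assumes "apex d Y a" "Y \<subseteq> M" "finite Y"
  shows "complete_multipartite (diametrical_graph Y d) P \<longleftrightarrow> P = {{a}, Y - {a}}"
proof -
  have a: "a \<in> Y" "Y - {a} \<noteq> {}"
    and da: "\<And>z. z \<in> Y \<Longrightarrow> z \<noteq> a \<Longrightarrow> d a z = diam Y d \<and> d z a = diam Y d"
    and lt: "\<And>u v. u \<in> Y \<Longrightarrow> v \<in> Y \<Longrightarrow> u \<noteq> a \<Longrightarrow> v \<noteq> a \<Longrightarrow> d u v < diam Y d"
    using assms(1) commute by (auto simp: apex_def)
  obtain b where "b \<in> Y" "b \<noteq> a"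
    using a by blast
  \<comment> \<open>The strict bound at the pair \<open>b\<close>, \<open>b\<close> makes the
    diameter positive.\<close>
  then have "0 < diam Y d"
    using lt[of b b] nonneg[of b b] by linarith
  then have edge: "d u v = diam Y d \<longleftrightarrow> (u = a) \<noteq> (v = a)" if "u \<in> Y" "v \<in> Y" for u v
  proof (cases "u = a \<or> v = a")
    case True
    with that assms(2) \<open>0 < diam Y d\<close> show ?thesis
      using da[of u] da[of v] by auto
  next
    case False
    with lt[OF that] show ?thesis
      by simp
  qed
  show ?thesis
  proof
    assume mp: "complete_multipartite (diametrical_graph Y d) P"
    then have part: "partition_on Y P"
      by (simp add: complete_multipartite_def diametrical_graph_def dist_graph_def)
    have same: "A = B \<longleftrightarrow> d u v \<noteq> diam Y d" if "A \<in> P" "B \<in> P" "u \<in> A" "v \<in> B" for A B u v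
    proof -
      have "u \<in> Y" "v \<in> Y"
        using part that by (auto simp: partition_on_def)
      moreover have "u \<rightarrow>\<^bsub>diametrical_graph Y d\<^esub> v \<longleftrightarrow> A \<noteq> B"
        using mp that unfolding complete_multipartite_def by blast
      ultimately show ?thesis
        by (auto simp: diametrical_graph_def dist_graph_def)
    qed
    have same_part: "v \<in> A \<longleftrightarrow> ((u = a) = (v = a))" if "A \<in> P" "u \<in> A" "v \<in> Y" for A u v
    proof -
      obtain B where B: "B \<in> P" "v \<in> B"
        using part \<open>v \<in> Y\<close> by (auto simp: partition_on_def)
      have "u \<in> Y"
        using part that by (auto simp: partition_on_def)
      then have "A = B \<longleftrightarrow> ((u = a) = (v = a))"
        using same[of A B u v] edge[of u v] that B by blast
      moreover have "v \<in> A \<longleftrightarrow> A = B"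
        using part that(1) B by (auto simp: partition_on_def disjoint_def)
      ultimately show ?thesis
        by simp
    qed
    have class_of: "A = (if u = a then {a} else Y - {a})" if "A \<in> P" "u \<in> A" for A u
    proof -
      have "A \<subseteq> Y"
        using part that by (auto simp: partition_on_def)
      then show ?thesis
        using same_part[OF that] a by auto
    qed
    have "A \<in> {{a}, Y - {a}}" if "A \<in> P" for A
    proof -
      obtain u where "u \<in> A"
        using part \<open>A \<in> P\<close> unfolding partition_on_def by (metis equals0I)
      from class_of[OF that this] show ?thesis
        by (simp split: if_splits)
    qed
    moreover obtain A B where "A \<in> P" "a \<in> A" "B \<in> P" "b \<in> B"
      using part a \<open>b \<in> Y\<close> by (auto simp: partition_on_def)
    then have "{a} \<in> P" "Y - {a} \<in> P"
      using class_of[of A a] class_of[of B b] \<open>b \<noteq> a\<close> by auto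
    ultimately show "P = {{a}, Y - {a}}"
      by blast
  next
    assume P: "P = {{a}, Y - {a}}"
    moreover have "{a} \<noteq> Y - {a}"
      by blast
    ultimately have "card P = 2"
      by simp
    moreover have "partition_on Y P"
      using a P by (auto simp: partition_on_def disjoint_def)
    moreover have "u \<rightarrow>\<^bsub>diametrical_graph Y d\<^esub> v \<longleftrightarrow> u \<in> Y \<and> v \<in> Y \<and> (u = a) \<noteq> (v = a)" for u v
      using edge by (auto simp: diametrical_graph_def dist_graph_def)
    ultimately show "complete_multipartite (diametrical_graph Y d) P"
      using P a by (auto simp: complete_multipartite_def diametrical_graph_def dist_graph_def)
  qed
qed

text \<open>Each step down the tree of a comb removes one apex, so a node with several points has
  lost exactly \<open>p\<close> points at level \<open>p\<close>. One-point nodes are leaves at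
  varying levels, hence the separate alternative.\<close>

lemma tree_node_comb:
  assumes "tree_node M d Y p" "finite M" "comb d M"
  shows "(\<exists>y \<in> M. Y = {y}) \<or> comb d Y \<and> isolated_node Y \<and> card Y + p = card M"
  using assms(1)
proof induction
  case root
  have "M \<noteq> {}"
    using assms(3) by (cases rule: comb.cases) (auto simp: apex_def)
  with assms show ?case
    by (simp add: isolated_node_def)
next
  case (child Y m P Z)
  show ?case
  proof (cases "\<exists>y \<in> M. Y = {y}")
    case True
    then have "\<not> diam Y d > 0"
      using diam_pos_iff[of Y] by auto
    with child.hyps show ?thesis
      by blast
  next
    case False
    then have Y: "comb d Y" "isolated_node Y" "card Y + m = card M"
      using child.IH by auto
    then have fin: "finite Y" and sub: "Y \<subseteq> M"
      using assms(2) by (auto simp: isolated_node_def intro: finite_subset)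
    from Y(1) obtain a where a: "apex d Y a" "comb d (Y - {a})"
      using False sub by (cases rule: comb.cases) auto
    then have "P = {{a}, Y - {a}}"
      using child.hyps diametrical_graph_multipartite_iff sub fin by blast
    then consider "Z = {a}" | "Z = Y - {a}"
      using child.hyps by blast
    then show ?thesis
    proof cases
      case 1
      then show ?thesis
        using a sub by (auto simp: apex_def)
    next
      case 2
      have "a \<in> Y"
        using a by (simp add: apex_def)
      then have "card Z + Suc m = card M"
        using 2 Y(3) card_Suc_Diff1[OF fin, of a] by simp
      with 2 a Y assms(2) show ?thesis
        using isolated_node_apex by blast
    qed
  qed
qed

text \<open>By \<open>card Y + p = card M\<close> the star prescribed at level \<open>p\<close> has
  \<open>card Y\<close> vertices, so it produces an apex \<open>a\<close>, and
  \<open>Y - {a}\<close> is a node of level \<open>Suc p\<close> with the same invariants.\<close>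

lemma comb_if_stars:
  assumes "finite M"
    and stars: "\<And>Y p. tree_node M d Y p \<Longrightarrow> diam Y d > 0 \<Longrightarrow>
      digraph_iso (dist_graph' (diam Y d) M d) (complete_bipartite 1 (card M - 1 - p))"
    and "tree_node M d Y p" "isolated_node Y" "card Y + p = card M"
  shows "comb d Y"
  using assms(3-)
proof (induction "card Y" arbitrary: Y p rule: less_induct)
  case less
  have fin: "finite Y" and sub: "Y \<subseteq> M" and ne: "Y \<noteq> {}"
    using less.prems assms(1) by (auto simp: isolated_node_def intro: finite_subset)
  show ?case
  proof (cases "card Y \<ge> 2")
    case True
    then have pos: "diam Y d > 0"
      using diam_pos_iff[OF sub fin ne] by simp
    \<comment> \<open>Since \<open>card Y \<ge> 2\<close>, the level \<open>p\<close> is at most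
      \<open>card M - 2\<close> and the truncated subtraction is exact.\<close>
    have "card Y = Suc (card M - 1 - p)" "card M - 1 - p > 0"
      using True less.prems(3) by auto
    then obtain a where a: "apex d Y a"
      using star_iff_apex[OF less.prems(2) assms(1)] stars[OF less.prems(1) pos] by blast
    then have mem: "a \<in> Y"
      by (simp add: apex_def)
    have "tree_node M d (Y - {a}) (Suc p)"
      using less.prems(1) pos diametrical_graph_multipartite_iff[OF a sub fin]
      by (intro tree_node.child[of _ _ _ _ "{{a}, Y - {a}}"]) auto
    moreover have "isolated_node (Y - {a})"
      using less.prems(2) a assms(1) by (rule isolated_node_apex)
    moreover have "card (Y - {a}) < card Y" "card (Y - {a}) + Suc p = card M"
      using mem fin less.prems(3) card_Suc_Diff1[OF fin mem] by auto
    ultimately have "comb d (Y - {a})"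
      using less.hyps by blast
    with a show ?thesis
      by (rule comb.peel)
  next
    case False
    moreover have "card Y > 0"
      using fin ne by (simp add: card_gt_0_iff)
    ultimately have "card Y = 1"
      by linarith
    then obtain y where "Y = {y}"
      by (auto simp: card_1_singleton_iff)
    then show ?thesis
      by (simp add: comb.singleton)
  qed
qed

end

theorem proposition4p3:
  fixes X :: "'a set" and d :: "'a \<Rightarrow> 'a \<Rightarrow> real" and n :: nat
  assumes "Ultrametric_space X d" and "finite X" and "card X \<ge> 2"
    and "n = card X - 1"
  shows "class_R X d \<longleftrightarrow>
    (\<forall>r \<in> Sp X d. r > 0 \<longrightarrow>
      (\<forall>Y p. tree_node X d Y p \<and> tree_label d Y = r \<longrightarrow>
        digraph_iso (dist_graph' r X d) (complete_bipartite 1 (n - p))))"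
    (is "_ \<longleftrightarrow> ?stars")
proof -
  interpret Ultrametric_space X d
    by fact
  have "comb d X \<longleftrightarrow> ?stars"
  proof
    assume comb: "comb d X"
    show ?stars
    proof (intro ballI impI allI, elim conjE)
      fix r Y p assume r: "0 < r" and Y: "tree_node X d Y p" "tree_label d Y = r"
      \<comment> \<open>The positive label excludes the one-point alternative of
        \<open>tree_node_comb\<close>.\<close>
      have "\<not> (\<exists>y \<in> X. Y = {y})"
        using diam_pos_iff[of Y] r Y(2) by auto
      then have node: "comb d Y" "isolated_node Y" "card Y + p = card X"
        using tree_node_comb[OF Y(1) assms(2) comb] by auto
      then have sub: "Y \<subseteq> X" "finite Y" "Y \<noteq> {}"
        using assms(2) by (auto simp: isolated_node_def intro: finite_subset)
      then have "card Y \<ge> 2"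
        using diam_pos_iff r Y(2) by blast
      then have "card Y = Suc (n - p)" "n - p > 0"
        using node(3) assms(4) by auto
      moreover have "\<exists>a. apex d Y a"
        using node(1) \<open>card Y \<ge> 2\<close> by (cases rule: comb.cases) auto
      ultimately show "digraph_iso (dist_graph' r X d) (complete_bipartite 1 (n - p))"
        using star_iff_apex[OF node(2) assms(2)] Y(2) by blast
    qed
  next
    assume stars: ?stars
    show "comb d X"
    proof (rule comb_if_stars[OF assms(2)])
      fix Y p assume Y: "tree_node X d Y p" "0 < diam Y d"
      then have "Y \<subseteq> X" "Y \<noteq> {}"
        using tree_node_subset[of X d Y p] assms(3) by fastforce+
      then have "diam Y d \<in> Sp X d"
        using diam_in_Sp[of Y d] assms(2) finite_subset[of Y X] by (auto simp: Sp_def)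
      with stars Y assms(4)
      show "digraph_iso (dist_graph' (diam Y d) X d) (complete_bipartite 1 (card X - 1 - p))"
        by blast
    \<comment> \<open>The root is isolated vacuously, as no point lies outside
      \<open>X\<close>.\<close>
    qed (use assms(3) in \<open>auto simp: isolated_node_def intro: tree_node.root\<close>)
  qed
  with class_R_iff_comb[OF assms(2,3)] show ?thesis
    by simp
qed

end
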